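(* For every integer $n \geq 7$, $f_3(2,n) \leq \left\lfloor \frac{(n+1)^2}{4}\right\rfloor - 2$.
   Context: A triple system ($3$-uniform hypergraph) is a pair $H=(V,E)$ where $V$ is a nonempty finite set of vertices and $E\subseteq\binom{V}{3}$ (the set of $3$-element subsets of $V$). A set $X\subseteq V$ is a clique of $H$ if $\binom{X}{3}\subseteq E$ (so every set with fewer than $3$ vertices is a clique). A clique is maximal if it is maximal with respect to inclusion, and $c(H)$ is the number of maximal cliques of $H$. The complement of $H$ is $\overline H=(V,\binom{V}{3}\setminus E)$. For $n\ge1$, $f_3(2,n)$ is the minimum of $c(H)+c(\overline H)$ over all triple systems $H$ with $n$ vertices. *)

theory Defs
  imports Complex_Main "HOL-Library.Ramsey"
begin

text \<open>
  The library set \<open>nsets V 3\<close> consists of the finite subsets of \<open>V\<close> with exactly 3 elements.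
  A triple system \<open>(V, E)\<close> is passed as two arguments \<open>V\<close> and \<open>E\<close>.
\<close>

definition triple_system :: "'a set \<Rightarrow> 'a set set \<Rightarrow> bool" where
  "triple_system V E \<longleftrightarrow> finite V \<and> V \<noteq> {} \<and> E \<subseteq> nsets V 3"

definition complement_edges :: "'a set \<Rightarrow> 'a set set \<Rightarrow> 'a set set" where
  "complement_edges V E = nsets V 3 - E"

definition triple_clique :: "'a set \<Rightarrow> 'a set set \<Rightarrow> 'a set \<Rightarrow> bool" where
  "triple_clique V E X \<longleftrightarrow> X \<subseteq> V \<and> nsets X 3 \<subseteq> E"

definition maximal_cliques :: "'a set \<Rightarrow> 'a set set \<Rightarrow> 'a set set" where
  "maximal_cliques V E =
     {X. triple_clique V E X \<and> (\<forall>Y. triple_clique V E Y \<and> X \<subseteq> Y \<longrightarrow> Y = X)}"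

definition num_maximal_cliques :: "'a set \<Rightarrow> 'a set set \<Rightarrow> nat" where
  "num_maximal_cliques V E = card (maximal_cliques V E)"

text \<open>
  The minimum ranges over triple systems whose vertices are natural numbers. This is no
  restriction: \<open>f3_2_attained\<close> and \<open>f3_2_le\<close> below show that it is attained and that it is a
  lower bound for triple systems over every vertex type.
\<close>

definition f3_2 :: "nat \<Rightarrow> nat" where
  "f3_2 n = (LEAST m. \<exists>(V :: nat set) E. triple_system V E \<and> card V = n \<and>
     m = num_maximal_cliques V E + num_maximal_cliques V (complement_edges V E))"

lemma f3_2_attained:
  assumes "n \<ge> 1"
  shows "\<exists>(V :: nat set) E. triple_system V E \<and> card V = n \<and>
     f3_2 n = num_maximal_cliques V E + num_maximal_cliques V (complement_edges V E)"
proof -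
  have "triple_system {..<n} {}" "card {..<n} = n"
    using assms by (auto simp: triple_system_def lessThan_empty_iff bot_nat_def)
  then have "\<exists>m. \<exists>(V :: nat set) E. triple_system V E \<and> card V = n \<and>
     m = num_maximal_cliques V E + num_maximal_cliques V (complement_edges V E)"
    by blast
  from LeastI_ex [OF this] show ?thesis
    unfolding f3_2_def .
qed

lemma inj_on_image_subset:
  assumes "inj_on g V" "X \<subseteq> V" "Y \<subseteq> V"
  shows "g ` X \<subseteq> g ` Y \<longleftrightarrow> X \<subseteq> Y"
proof
  assume sub: "g ` X \<subseteq> g ` Y"
  show "X \<subseteq> Y"
  proof
    fix x assume "x \<in> X"
    with sub obtain y where "y \<in> Y" "g x = g y" by auto
    with assms \<open>x \<in> X\<close> show "x \<in> Y" by (metis inj_onD subsetD)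
  qed
qed (rule image_mono)

lemma nsets_image:
  assumes "inj_on g V" "X \<subseteq> V"
  shows "nsets (g ` X) k = (`) g ` nsets X k"
proof -
  have g: "inj_on g X"
    using assms inj_on_subset by blast
  have "N \<in> (`) g ` nsets X k" if "N \<in> nsets (g ` X) k" for N
  proof -
    from that obtain M where M: "M \<subseteq> X" "N = g ` M"
      by (auto simp: nsets_def subset_image_iff)
    moreover have "inj_on g M"
      using g M inj_on_subset by blast
    ultimately have "M \<in> nsets X k"
      using that by (auto simp: nsets_def card_image finite_image_iff)
    with M show ?thesis by blast
  qed
  moreover have "g ` M \<in> nsets (g ` X) k" if "M \<in> nsets X k" for M
    using that inj_on_subset [OF g, of M] by (auto simp: nsets_def card_image)
  ultimately show ?thesis by blast
qed

lemma triple_clique_image: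
  assumes g: "inj_on g V" and E: "E \<subseteq> nsets V 3" and X: "X \<subseteq> V"
  shows "triple_clique (g ` V) ((`) g ` E) (g ` X) \<longleftrightarrow> triple_clique V E X"
proof -
  have inj: "inj_on ((`) g) (Pow V)"
    using g by (rule inj_on_image_Pow)
  have "nsets X 3 \<subseteq> Pow V" "E \<subseteq> Pow V"
    using X E by (auto simp: nsets_def)
  with inj have "(`) g ` nsets X 3 \<subseteq> (`) g ` E \<longleftrightarrow> nsets X 3 \<subseteq> E"
    by (rule inj_on_image_subset)
  then show ?thesis
    using X nsets_image [OF g X] by (auto simp: triple_clique_def)
qed

lemma num_maximal_cliques_image:
  assumes g: "inj_on g V" and E: "E \<subseteq> nsets V 3"
  shows "num_maximal_cliques (g ` V) ((`) g ` E) = num_maximal_cliques V E"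
proof -
  note tc = triple_clique_image [OF g E]
  have sub: "X \<subseteq> V" if "triple_clique V E X" for X
    using that by (simp add: triple_clique_def)
  have img: "\<exists>X. Y = g ` X \<and> X \<subseteq> V" if "triple_clique (g ` V) ((`) g ` E) Y" for Y
    using that by (auto simp: triple_clique_def subset_image_iff)
  have le: "g ` X \<subseteq> g ` Y \<longleftrightarrow> X \<subseteq> Y" "g ` X = g ` Y \<longleftrightarrow> X = Y"
    if "X \<subseteq> V" "Y \<subseteq> V" for X Y
    using that g by (simp_all add: inj_on_image_subset inj_on_image_eq_iff)
  have mx: "g ` X \<in> maximal_cliques (g ` V) ((`) g ` E) \<longleftrightarrow> X \<in> maximal_cliques V E"
    if X: "X \<subseteq> V" for X
  proof
    assume "g ` X \<in> maximal_cliques (g ` V) ((`) g ` E)"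
    then have X': "triple_clique (g ` V) ((`) g ` E) (g ` X)"
      and max: "\<And>Y. triple_clique (g ` V) ((`) g ` E) Y \<Longrightarrow> g ` X \<subseteq> Y \<Longrightarrow> Y = g ` X"
      by (auto simp: maximal_cliques_def)
    have "Z = X" if "triple_clique V E Z" "X \<subseteq> Z" for Z
      using max [of "g ` Z"] tc [of Z] le [of Z X] sub [OF that(1)] X that
      by (simp add: image_mono)
    then show "X \<in> maximal_cliques V E"
      using X X' by (auto simp: maximal_cliques_def tc)
  next
    assume "X \<in> maximal_cliques V E"
    then have X': "triple_clique V E X"
      and max: "\<And>Z. triple_clique V E Z \<Longrightarrow> X \<subseteq> Z \<Longrightarrow> Z = X"
      by (auto simp: maximal_cliques_def)
    have "Y = g ` X" if "triple_clique (g ` V) ((`) g ` E) Y" "g ` X \<subseteq> Y" for Y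
    proof -
      obtain Z where "Y = g ` Z" "Z \<subseteq> V"
        using img [OF \<open>triple_clique (g ` V) ((`) g ` E) Y\<close>] by (elim exE conjE)
      with that show ?thesis
        using max [of Z] X tc [of Z] le [of X Z] by simp
    qed
    then show "g ` X \<in> maximal_cliques (g ` V) ((`) g ` E)"
      using X X' by (auto simp: maximal_cliques_def tc)
  qed
  have eq: "maximal_cliques (g ` V) ((`) g ` E) = (`) g ` maximal_cliques V E"
  proof (intro equalityI subsetI)
    fix Y assume Y: "Y \<in> maximal_cliques (g ` V) ((`) g ` E)"
    then have "triple_clique (g ` V) ((`) g ` E) Y"
      by (simp add: maximal_cliques_def)
    from img [OF this] obtain X where X: "Y = g ` X" "X \<subseteq> V"
      by (elim exE conjE)
    with Y mx have "X \<in> maximal_cliques V E" by simp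
    with X show "Y \<in> (`) g ` maximal_cliques V E" by simp
  next
    fix Y assume "Y \<in> (`) g ` maximal_cliques V E"
    then obtain X where X: "Y = g ` X" "X \<in> maximal_cliques V E" by (elim imageE)
    moreover from X have "X \<subseteq> V"
      using sub by (simp add: maximal_cliques_def)
    ultimately show "Y \<in> maximal_cliques (g ` V) ((`) g ` E)"
      using mx by simp
  qed
  have "maximal_cliques V E \<subseteq> Pow V"
    using sub by (auto simp: maximal_cliques_def)
  with inj_on_image_Pow [OF g] have "inj_on ((`) g) (maximal_cliques V E)"
    by (rule inj_on_subset)
  then show ?thesis
    unfolding num_maximal_cliques_def eq by (rule card_image)
qed

lemma f3_2_le:
  fixes V :: "'a set"
  assumes "triple_system V E" "card V = n"
  shows "f3_2 n \<le> num_maximal_cliques V E + num_maximal_cliques V (complement_edges V E)"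
proof -
  have V: "finite V" "V \<noteq> {}" and E: "E \<subseteq> nsets V 3"
    using assms by (auto simp: triple_system_def)
  obtain g :: "'a \<Rightarrow> nat" where g: "inj_on g V"
    using finite_imp_inj_to_nat_seg [OF V(1)] by blast
  have nV: "nsets (g ` V) 3 = (`) g ` nsets V 3"
    using g by (rule nsets_image) simp
  have C: "complement_edges V E \<subseteq> nsets V 3"
    by (auto simp: complement_edges_def)
  have "inj_on ((`) g) (nsets V 3)"
    by (rule inj_on_subset [OF inj_on_image_Pow [OF g]]) (auto simp: nsets_def)
  then have cE: "complement_edges (g ` V) ((`) g ` E) = (`) g ` complement_edges V E"
    using E by (simp add: complement_edges_def nV inj_on_image_set_diff)
  have "triple_system (g ` V) ((`) g ` E)" "card (g ` V) = n"
    using V E nV g assms(2) by (auto simp: triple_system_def card_image)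
  then have "f3_2 n \<le> num_maximal_cliques (g ` V) ((`) g ` E)
      + num_maximal_cliques (g ` V) (complement_edges (g ` V) ((`) g ` E))"
    unfolding f3_2_def by (intro Least_le exI conjI) simp_all
  then show ?thesis
    by (simp add: cE num_maximal_cliques_image [OF g E] num_maximal_cliques_image [OF g C])
qed

end

theory Submission
  imports Defs
begin

text \<open>
  The Fano plane is a triple system on 7 vertices with 14 maximal cliques in all. Its maximal
  cliques are the 7 lines, since any two points lie on a unique line. In the complement a clique
  is a point set that contains no line; since the plane has no 2-colouring without a
  monochromatic line, such a set misses some line, so the maximal ones are the 7 complements of
  lines. Hence \<open>f3_2 7 \<le> 14\<close>, and every point is on 3 lines and in 4 of their complements
  (\<open>has_covers_fano\<close>).

  Larger systems arise by giving a vertex \<open>v\<close> a twin \<open>v'\<close>: the triples through \<open>v'\<close> copy those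
  through \<open>v\<close>, and no edge contains both. If \<open>d\<close> maximal cliques contain \<open>v\<close>, these have copies
  through \<open>v'\<close>, and \<open>{v, v'}\<close> becomes a maximal clique, so there are \<open>d + 1\<close> more of them, and
  \<open>d + 1\<close> now contain \<open>v\<close>. In the complement every maximal clique through \<open>v\<close> just absorbs \<open>v'\<close>,
  so neither the number of maximal cliques nor the number of those through \<open>v\<close> changes
  (\<open>has_covers_twin\<close>).

  The same step applied to the complement exchanges the two roles. Always twinning the same
  vertex, alternately in the system and in its complement, raises the two numbers at \<open>v\<close> from
  \<open>(3, 4)\<close> to \<open>(4, 4)\<close>, \<open>(4, 5)\<close>, \<open>(5, 5)\<close> and so on. The step from \<open>n\<close> to \<open>n + 1\<close> vertices
  therefore costs \<open>\<lfloor>n / 2\<rfloor> + 1\<close>, which is exactly the growth of \<open>\<lfloor>(n + 1)\<^sup>2 / 4\<rfloor>\<close>.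
\<close>

section \<open>Covering the cliques\<close>

text \<open>
  For an upper bound it suffices to know some finite family of cliques that catches every
  clique. Such a family must contain all maximal cliques, but may contain others; so maximality
  never has to be checked when a family is transformed.
\<close>

definition clique_cover :: "'a set \<Rightarrow> 'a set set \<Rightarrow> 'a set set \<Rightarrow> bool" where
  "clique_cover V E F \<longleftrightarrow> finite F \<and> (\<forall>C\<in>F. triple_clique V E C) \<and>
     (\<forall>X. triple_clique V E X \<longrightarrow> (\<exists>C\<in>F. X \<subseteq> C))"

lemma num_maximal_cliques_le_card_cover:
  assumes "clique_cover V E F"
  shows "num_maximal_cliques V E \<le> card F"
proof -
  have "maximal_cliques V E \<subseteq> F"
    using assms unfolding maximal_cliques_def clique_cover_def by blast
  then show ?thesis
    using assms by (simp add: num_maximal_cliques_def clique_cover_def card_mono)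
qed

lemma complement_edges_complement_edges:
  "E \<subseteq> nsets V 3 \<Longrightarrow> complement_edges V (complement_edges V E) = E"
  by (auto simp: complement_edges_def)

section \<open>Pulling back a triple system\<close>

definition pullback_edges :: "('b \<Rightarrow> 'a) \<Rightarrow> 'b set \<Rightarrow> 'a set set \<Rightarrow> 'b set set" where
  "pullback_edges p W E = {e \<in> nsets W 3. p ` e \<in> E}"

lemma complement_pullback_edges:
  "complement_edges W (pullback_edges p W E) = {e \<in> nsets W 3. p ` e \<notin> E}"
  by (auto simp: complement_edges_def pullback_edges_def)

text \<open>
  A triple on which \<open>p\<close> is not injective has an image with fewer than 3 elements, so it is never
  an edge of the pullback. Hence it never obstructs a clique of the complement.
\<close>

lemma triple_clique_complement_pullback:
  assumes "p ` W \<subseteq> V" "E \<subseteq> nsets V 3" "X \<subseteq> W"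
  shows "triple_clique W (complement_edges W (pullback_edges p W E)) X \<longleftrightarrow>
    triple_clique V (complement_edges V E) (p ` X)"
proof
  assume X: "triple_clique W (complement_edges W (pullback_edges p W E)) X"
  have "M \<in> complement_edges V E" if M: "M \<in> nsets (p ` X) 3" for M
  proof -
    from M have "M \<subseteq> p ` X"
      by (simp add: nsets_def)
    then obtain N where N: "N \<subseteq> X" "inj_on p N" "M = p ` N"
      by (auto simp: subset_image_inj)
    with M have "N \<in> nsets X 3"
      by (auto simp: nsets_def card_image finite_image_iff)
    with X N have "M \<notin> E"
      by (auto simp: triple_clique_def complement_pullback_edges)
    moreover have "M \<in> nsets V 3"
      using M assms(1,3) unfolding nsets_def by blast
    ultimately show ?thesis
      by (simp add: complement_edges_def)
  qed
  moreover have "p ` X \<subseteq> V"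
    using assms(1,3) by blast
  ultimately show "triple_clique V (complement_edges V E) (p ` X)"
    by (auto simp: triple_clique_def)
next
  assume X: "triple_clique V (complement_edges V E) (p ` X)"
  have "p ` e \<notin> E" if e: "e \<in> nsets X 3" for e
  proof
    assume "p ` e \<in> E"
    with e assms(2) have "p ` e \<in> nsets (p ` X) 3"
      by (auto simp: nsets_def)
    with X \<open>p ` e \<in> E\<close> show False
      by (auto simp: triple_clique_def complement_edges_def)
  qed
  then show "triple_clique W (complement_edges W (pullback_edges p W E)) X"
    using assms(3) by (auto simp: triple_clique_def complement_pullback_edges nsets_def)
qed

lemma triple_clique_pullback_inj:
  assumes "p ` W \<subseteq> V" "X \<subseteq> W" "inj_on p X"
  shows "triple_clique W (pullback_edges p W E) X \<longleftrightarrow> triple_clique V E (p ` X)"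
proof -
  have "nsets X 3 \<subseteq> nsets W 3" "p ` X \<subseteq> V"
    using assms by (auto simp: nsets_def)
  then show ?thesis
    using assms(2) nsets_image[OF assms(3) order_refl, of 3]
    by (auto simp: triple_clique_def pullback_edges_def)
qed

text \<open>
  A clique of the pullback identifies two of its points under \<open>p\<close> only if it has no third point,
  since those two and the third would form a triple with too small an image.
\<close>

lemma triple_clique_pullback_cases:
  assumes X: "triple_clique W (pullback_edges p W E) X" and E: "E \<subseteq> nsets V 3"
  obtains "inj_on p X" | a b where "X = {a, b}" "a \<noteq> b" "p a = p b"
proof (cases "inj_on p X")
  case False
  then obtain a b where ab: "a \<in> X" "b \<in> X" "a \<noteq> b" "p a = p b"
    by (auto simp: inj_on_def)
  have "c = a \<or> c = b" if c: "c \<in> X" for c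
  proof (rule ccontr)
    assume "\<not> (c = a \<or> c = b)"
    with ab c have "{a, b, c} \<in> nsets X 3"
      by (auto simp: nsets_def)
    with X have "p ` {a, b, c} \<in> E"
      unfolding triple_clique_def pullback_edges_def by blast
    with E have "card (p ` {a, b, c}) = 3"
      by (auto simp: nsets_def)
    moreover have "card (p ` {a, b, c}) \<le> 2"
      using ab(4) card_insert_le_m1[of 2 "{p c}" "p b"] by simp
    ultimately show False
      by simp
  qed
  with ab have "X = {a, b}"
    by auto
  with ab show ?thesis
    using that(2) by blast
qed (use that(1) in blast)

text \<open>
  By the previous equivalence the cliques of the complement are the sets lying over cliques
  downstairs, so full preimages of the members of a cover suffice, one for each member.
\<close>

lemma clique_cover_complement_pullback:
  assumes p: "p ` W = V" and E: "E \<subseteq> nsets V 3"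
    and G: "clique_cover V (complement_edges V E) G"
  shows "clique_cover W (complement_edges W (pullback_edges p W E))
    ((\<lambda>C. {x \<in> W. p x \<in> C}) ` G)"
proof -
  note iff = triple_clique_complement_pullback[OF equalityD1[OF p] E]
  have "triple_clique W (complement_edges W (pullback_edges p W E)) {x \<in> W. p x \<in> C}"
    if C: "C \<in> G" for C
  proof -
    have "triple_clique V (complement_edges V E) C"
      using C G by (simp add: clique_cover_def)
    moreover from this have "p ` {x \<in> W. p x \<in> C} = C"
      using p by (auto simp: triple_clique_def)
    ultimately show ?thesis
      by (subst iff) auto
  qed
  moreover have "\<exists>C\<in>G. X \<subseteq> {x \<in> W. p x \<in> C}"
    if X: "triple_clique W (complement_edges W (pullback_edges p W E)) X" for X
  proof -
    have "X \<subseteq> W"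
      using X by (simp add: triple_clique_def)
    with X G obtain C where "C \<in> G" "p ` X \<subseteq> C"
      unfolding clique_cover_def by (meson iff)
    with \<open>X \<subseteq> W\<close> show ?thesis
      by auto
  qed
  ultimately show ?thesis
    using G by (auto simp: clique_cover_def)
qed

section \<open>Twinning a vertex\<close>

definition twin_map :: "'a \<Rightarrow> 'a \<Rightarrow> 'a \<Rightarrow> 'a" where
  "twin_map v v' x = (if x = v' then v else x)"

definition twin_cover :: "'a \<Rightarrow> 'a \<Rightarrow> 'a set set \<Rightarrow> 'a set set" where
  "twin_cover v v' F = F \<union> (\<lambda>C. insert v' (C - {v})) ` {C \<in> F. v \<in> C} \<union> {{v, v'}}"

lemma twin_map_image:
  assumes "v \<in> V" "v' \<notin> V"
  shows "twin_map v v' ` insert v' V = V"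
  using assms by (auto simp: twin_map_def image_iff)

lemma twin_cover_card:
  assumes "finite F"
  shows "card (twin_cover v v' F) \<le> card F + card {C \<in> F. v \<in> C} + 1"
proof -
  let ?R = "(\<lambda>C. insert v' (C - {v})) ` {C \<in> F. v \<in> C}"
  have "card (twin_cover v v' F) \<le> card F + card ?R + card {{v, v'}}"
    unfolding twin_cover_def by (meson add_mono card_Un_le le_trans order_refl)
  moreover have "card ?R \<le> card {C \<in> F. v \<in> C}"
    using assms by (intro card_image_le) simp
  ultimately show ?thesis
    by simp
qed

text \<open>The copies trade \<open>v\<close> for \<open>v'\<close>, so \<open>{v, v'}\<close> is the only new member through \<open>v\<close>.\<close>

lemma twin_cover_degree:
  assumes "finite F" "v \<noteq> v'"
  shows "card {C \<in> twin_cover v v' F. v \<in> C} \<le> card {C \<in> F. v \<in> C} + 1"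
proof -
  have "{C \<in> twin_cover v v' F. v \<in> C} \<subseteq> insert {v, v'} {C \<in> F. v \<in> C}"
    using assms(2) by (auto simp: twin_cover_def)
  then have "card {C \<in> twin_cover v v' F. v \<in> C} \<le> card (insert {v, v'} {C \<in> F. v \<in> C})"
    using assms(1) by (intro card_mono) auto
  then show ?thesis
    using assms(1) card_insert_le_m1[of "card {C \<in> F. v \<in> C} + 1" "{C \<in> F. v \<in> C}" "{v, v'}"]
    by simp
qed

text \<open>
  Twinning is the pullback along the map that sends \<open>v'\<close> to \<open>v\<close> and fixes everything else. A
  clique other than \<open>{v, v'}\<close> cannot contain both twins. If it contains \<open>v'\<close>, renaming \<open>v'\<close> to
  \<open>v\<close> gives an old clique, and the copy of the member above that one covers it.
\<close>

lemma clique_cover_twin: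
  assumes v: "v \<in> V" "v' \<notin> V" and E: "E \<subseteq> nsets V 3" and F: "clique_cover V E F"
  shows "clique_cover (insert v' V) (pullback_edges (twin_map v v') (insert v' V) E)
    (twin_cover v v' F)"
proof -
  let ?p = "twin_map v v'" and ?W = "insert v' V"
  have p: "?p ` ?W \<subseteq> V"
    using twin_map_image[OF v] by simp
  note iff = triple_clique_pullback_inj[OF p]
  have sub: "C \<subseteq> V" if "C \<in> F" for C
    using F that by (simp add: clique_cover_def triple_clique_def)
  have old: "triple_clique ?W (pullback_edges ?p ?W E) C" if C: "C \<in> F" for C
  proof -
    have "?p x = x" if "x \<in> C" for x
      using that sub[OF C] v by (auto simp: twin_map_def)
    then have "inj_on ?p C" "?p ` C = C"
      by (auto simp: inj_on_def)
    moreover have "triple_clique V E C"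
      using C F by (simp add: clique_cover_def)
    ultimately show ?thesis
      using sub[OF C] by (subst iff) auto
  qed
  have copy: "triple_clique ?W (pullback_edges ?p ?W E) (insert v' (C - {v}))"
    if C: "C \<in> F" "v \<in> C" for C
  proof -
    have "inj_on ?p (insert v' (C - {v}))"
      by (auto simp: twin_map_def inj_on_def)
    moreover have "?p ` insert v' (C - {v}) = C"
      using sub[OF C(1)] v C(2) by (auto simp: twin_map_def image_iff)
    moreover have "triple_clique V E C"
      using C F by (simp add: clique_cover_def)
    ultimately show ?thesis
      using sub[OF C(1)] by (subst iff) auto
  qed
  have "nsets {v, v'} 3 = {}"
    by (rule nsets_eq_empty) (use v in \<open>auto simp: card_insert_if\<close>)
  then have pair: "triple_clique ?W (pullback_edges ?p ?W E) {v, v'}"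
    using v by (simp add: triple_clique_def)
  have "\<exists>C\<in>twin_cover v v' F. X \<subseteq> C"
    if X: "triple_clique ?W (pullback_edges ?p ?W E) X" for X
    using X E
  proof (cases rule: triple_clique_pullback_cases)
    case 1
    have "X \<subseteq> ?W"
      using X by (simp add: triple_clique_def)
    with 1 X F obtain C where C: "C \<in> F" "?p ` X \<subseteq> C"
      unfolding clique_cover_def by (meson iff)
    show ?thesis
    proof (cases "v' \<in> X")
      case True
      have "v \<in> C"
        using True C by (auto simp: twin_map_def)
      moreover have "v \<notin> X"
        using True v inj_onD[OF 1, of v v'] by (auto simp: twin_map_def)
      then have "X \<subseteq> insert v' (C - {v})"
        using C by (auto simp: twin_map_def split: if_splits)
      ultimately show ?thesis
        using C by (auto simp: twin_cover_def)
    next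
      case False
      then have "X \<subseteq> C"
        using C by (auto simp: twin_map_def split: if_splits)
      with C show ?thesis
        by (auto simp: twin_cover_def)
    qed
  next
    case (2 a b)
    then have "X = {v, v'}"
      by (auto simp: twin_map_def split: if_splits)
    then show ?thesis
      by (auto simp: twin_cover_def)
  qed
  then show ?thesis
    using F old copy pair by (auto simp: clique_cover_def twin_cover_def)
qed

section \<open>Systems with few maximal cliques\<close>

text \<open>
  The bounds \<open>d\<close> and \<open>d'\<close> on the members through one vertex \<open>v\<close> are recorded next to the total
  \<open>c\<close>, because they are what twinning \<open>v\<close> in the system or in its complement will cost.
\<close>

definition has_covers :: "nat \<Rightarrow> nat \<Rightarrow> nat \<Rightarrow> nat \<Rightarrow> bool" where
  "has_covers n c d d' \<longleftrightarrow> (\<exists>(V :: nat set) E F G v. finite V \<and> card V = n \<and> v \<in> V \<and>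
     E \<subseteq> nsets V 3 \<and> clique_cover V E F \<and> clique_cover V (complement_edges V E) G \<and>
     card F + card G \<le> c \<and> card {C \<in> F. v \<in> C} \<le> d \<and> card {C \<in> G. v \<in> C} \<le> d')"

lemma has_covers_complement:
  assumes "has_covers n c d d'"
  shows "has_covers n c d' d"
proof -
  obtain V :: "nat set" and E F G v where *: "finite V" "card V = n" "v \<in> V"
    "E \<subseteq> nsets V 3" "clique_cover V E F" "clique_cover V (complement_edges V E) G"
    "card F + card G \<le> c" "card {C \<in> F. v \<in> C} \<le> d" "card {C \<in> G. v \<in> C} \<le> d'"
    using assms unfolding has_covers_def by blast
  have "complement_edges V E \<subseteq> nsets V 3"
    by (auto simp: complement_edges_def)
  with * show ?thesis
    unfolding has_covers_def
    by (intro exI[of _ V] exI[of _ "complement_edges V E"] exI[of _ G] exI[of _ F] exI[of _ v])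
      (simp add: complement_edges_complement_edges add.commute)
qed

lemma has_covers_twin:
  assumes "has_covers n c d d'"
  shows "has_covers (n + 1) (c + d + 1) (d + 1) d'"
proof -
  obtain V :: "nat set" and E F G v where *: "finite V" "card V = n" "v \<in> V"
    "E \<subseteq> nsets V 3" "clique_cover V E F" "clique_cover V (complement_edges V E) G"
    "card F + card G \<le> c" "card {C \<in> F. v \<in> C} \<le> d" "card {C \<in> G. v \<in> C} \<le> d'"
    using assms unfolding has_covers_def by blast
  obtain v' where v': "v' \<notin> V"
    using \<open>finite V\<close> ex_new_if_finite infinite_UNIV_nat by blast
  let ?p = "twin_map v v'" and ?W = "insert v' V"
  let ?h = "\<lambda>C. {x \<in> ?W. ?p x \<in> C}"
  let ?E = "pullback_edges ?p ?W E" and ?F = "twin_cover v v' F" and ?G = "?h ` G"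
  have fin: "finite F" "finite G"
    using * by (simp_all add: clique_cover_def)
  have "v \<noteq> v'"
    using * v' by auto
  have "clique_cover ?W ?E ?F"
    using *(3-5) v' by (intro clique_cover_twin)
  moreover have "clique_cover ?W (complement_edges ?W ?E) ?G"
    by (rule clique_cover_complement_pullback[OF twin_map_image[OF *(3) v'] *(4,6)])
  moreover have "card ?F + card ?G \<le> c + d + 1"
    using twin_cover_card[OF fin(1), of v v'] card_image_le[OF fin(2), of ?h] * by linarith
  moreover have "card {C \<in> ?F. v \<in> C} \<le> d + 1"
    using twin_cover_degree[OF fin(1) \<open>v \<noteq> v'\<close>] * by linarith
  moreover have "card {C \<in> ?G. v \<in> C} \<le> d'"
  proof -
    have "{C \<in> ?G. v \<in> C} \<subseteq> ?h ` {C \<in> G. v \<in> C}"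
      using \<open>v \<noteq> v'\<close> by (auto simp: twin_map_def)
    then have "card {C \<in> ?G. v \<in> C} \<le> card (?h ` {C \<in> G. v \<in> C})"
      using fin by (intro card_mono) auto
    also have "\<dots> \<le> card {C \<in> G. v \<in> C}"
      using fin by (intro card_image_le) simp
    finally show ?thesis
      using * by simp
  qed
  moreover have "?E \<subseteq> nsets ?W 3"
    by (auto simp: pullback_edges_def)
  moreover have "finite ?W" "card ?W = n + 1" "v \<in> ?W"
    using *(1-3) v' by simp_all
  ultimately show ?thesis
    unfolding has_covers_def by blast
qed

text \<open>
  The lines are the translates modulo 7 of \<open>{0, 1, 3}\<close>, a perfect difference set: every nonzero
  residue is the difference of exactly one ordered pair of its elements.
\<close>

definition fano_lines :: "nat set list" where
  "fano_lines = [{0,1,3}, {1,2,4}, {2,3,5}, {3,4,6}, {4,5,0}, {5,6,1}, {6,0,2}]"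

lemma has_covers_fano: "has_covers 7 14 3 4"
proof -
  define V where "V = {0,1,2,3,4,5,6 :: nat}"
  let ?E = "set fano_lines"
  let ?G = "map (\<lambda>L. V - L) fano_lines"
  have degree: "card {C \<in> set xs. P C} \<le> length (filter P xs)" for xs :: "nat set list" and P
    using card_length[of "filter P xs"] by simp
  have triples: "?E \<subseteq> nsets V 3"
    by (simp add: fano_lines_def nsets_def V_def)
  have card_line: "finite L" "card L = 3" if "L \<in> ?E" for L
    using that triples by (auto simp: nsets_def)
  have join: "\<forall>a\<in>V. \<forall>b\<in>V. \<exists>L\<in>?E. a \<in> L \<and> b \<in> L"
    by (simp add: fano_lines_def V_def)
  have meet: "\<forall>L\<in>?E. \<forall>M\<in>?E. L \<inter> M \<noteq> {}"
    by (simp add: fano_lines_def)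
  have unique: "\<forall>L\<in>?E. \<forall>M\<in>?E. \<forall>a\<in>L. \<forall>b\<in>L. a \<in> M \<longrightarrow> b \<in> M \<longrightarrow> a = b \<or> L = M"
    by (simp add: fano_lines_def)
  have "\<exists>L\<in>?E. X \<subseteq> L" if X: "triple_clique V ?E X" for X
  proof (cases "\<exists>a\<in>X. \<exists>b\<in>X. a \<noteq> b")
    case True
    then obtain a b where ab: "a \<in> X" "b \<in> X" "a \<noteq> b"
      by blast
    with X have "a \<in> V" "b \<in> V"
      unfolding triple_clique_def by blast+
    with join obtain L where L: "L \<in> ?E" "a \<in> L" "b \<in> L"
      by meson
    have "c \<in> L" if "c \<in> X" "c \<noteq> a" "c \<noteq> b" for c
    proof -
      have "{a, b, c} \<in> nsets X 3"
        using that ab by (simp add: nsets_def)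
      with X have M: "{a, b, c} \<in> ?E"
        unfolding triple_clique_def by blast
      have "L = {a, b, c}"
        using unique[rule_format, OF L(1) M L(2,3)] ab(3) by simp
      then show ?thesis
        by simp
    qed
    with L show ?thesis
      by blast
  next
    case False
    moreover have "X \<subseteq> V" "0 \<in> V"
      using X by (simp_all add: triple_clique_def V_def)
    ultimately obtain a where "a \<in> V" "X \<subseteq> {a}"
      by blast
    moreover from this join obtain L where "L \<in> ?E" "a \<in> L"
      by meson
    ultimately show ?thesis
      by blast
  qed
  moreover have "triple_clique V ?E L" if L: "L \<in> ?E" for L
  proof -
    have "M = L" if "M \<in> nsets L 3" for M
      using that card_line[OF L] card_subset_eq[of L M] by (simp add: nsets_def)
    moreover have "L \<subseteq> V"
      using L triples unfolding nsets_def by blast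
    ultimately show ?thesis
      using L unfolding triple_clique_def by blast
  qed
  ultimately have lines: "clique_cover V ?E ?E"
    unfolding clique_cover_def by simp
  have "\<exists>C\<in>set ?G. X \<subseteq> C" if X: "triple_clique V (complement_edges V ?E) X" for X
  proof -
    have "X \<subseteq> V"
      using X by (simp add: triple_clique_def)
    have "\<not> L \<subseteq> X" if L: "L \<in> ?E" for L
    proof
      assume "L \<subseteq> X"
      then have "L \<in> nsets X 3"
        using card_line[OF L] by (simp add: nsets_def)
      with L X show False
        unfolding triple_clique_def complement_edges_def by blast
    qed
    then have "\<forall>L\<in>?E. \<not> L \<subseteq> X"
      by blast
    \<comment> \<open>Otherwise \<open>X\<close> and its complement would 2-colour the plane without a monochromatic line.\<close>
    then have "\<exists>L\<in>?E. X \<inter> L = {}"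
      unfolding fano_lines_def by simp sat
    with \<open>X \<subseteq> V\<close> show ?thesis
      by auto
  qed
  moreover have "triple_clique V (complement_edges V ?E) C" if C: "C \<in> set ?G" for C
  proof -
    obtain L where L: "L \<in> ?E" "C = V - L"
      using C by auto
    have "M \<notin> ?E" if "M \<subseteq> C" for M
      using meet L that by blast
    moreover have "C \<subseteq> V"
      using L by blast
    ultimately show ?thesis
      unfolding triple_clique_def complement_edges_def nsets_def by blast
  qed
  ultimately have complements: "clique_cover V (complement_edges V ?E) (set ?G)"
    unfolding clique_cover_def by blast
  have "length fano_lines = 7"
    by (simp add: fano_lines_def)
  then have "card ?E + card (set ?G) \<le> 14"
    using card_length[of fano_lines] card_length[of ?G] unfolding length_map by linarith
  moreover have "card {C \<in> ?E. 0 \<in> C} \<le> 3" "card {C \<in> set ?G. 0 \<in> C} \<le> 4"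
  proof -
    have "length (filter (\<lambda>C. 0 \<in> C) fano_lines) = 3" "length (filter (\<lambda>C. 0 \<in> C) ?G) = 4"
      by (simp_all add: fano_lines_def V_def)
    then show "card {C \<in> ?E. 0 \<in> C} \<le> 3" "card {C \<in> set ?G. 0 \<in> C} \<le> 4"
      using degree[where P = "\<lambda>C. 0 \<in> C" and xs = fano_lines]
        degree[where P = "\<lambda>C. 0 \<in> C" and xs = ?G] by linarith+
  qed
  moreover have "finite V" "card V = 7" "0 \<in> V"
    by (simp_all add: V_def)
  ultimately show ?thesis
    unfolding has_covers_def using triples lines complements by blast
qed

text \<open>
  Each step twins in the system and then passes to the complement. The smaller of the two
  numbers at the vertex is thereby the one that grows next, so both stay near \<open>n / 2\<close>.
\<close>

lemma has_covers_ge_7: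
  assumes "n \<ge> 7"
  shows "has_covers n ((n + 1)\<^sup>2 div 4 - 2) (n div 2) ((n + 1) div 2)"
  using assms
proof (induction n rule: dec_induct)
  case base
  then show ?case
    using has_covers_fano by simp
next
  case (step n)
  have total: "((n + 1)\<^sup>2 div 4 - 2) + n div 2 + 1 = (Suc n + 1)\<^sup>2 div 4 - 2"
  proof -
    have "(n + 1)\<^sup>2 div 4 + n div 2 + 1 = (Suc n + 1)\<^sup>2 div 4"
    proof (cases "even n")
      case True
      then obtain k where n: "n = 2 * k"
        by blast
      have eqs: "(n + 1)\<^sup>2 = 4 * (k * k + k) + 1" "(Suc n + 1)\<^sup>2 = 4 * (k * k + 2 * k + 1)"
        "n div 2 = k"
        by (simp_all add: n power2_eq_square algebra_simps)
      show ?thesis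
        unfolding eqs by simp
    next
      case False
      then obtain k where n: "n = 2 * k + 1"
        by (elim oddE)
      have eqs: "(n + 1)\<^sup>2 = 4 * (k * k + 2 * k + 1)"
        "(Suc n + 1)\<^sup>2 = 4 * (k * k + 3 * k + 2) + 1" "n div 2 = k"
        by (simp_all add: n power2_eq_square algebra_simps)
      show ?thesis
        unfolding eqs by simp
    qed
    moreover have "8\<^sup>2 \<le> (n + 1)\<^sup>2"
      using step by (intro power_mono) auto
    ultimately show ?thesis by simp
  qed
  have degree: "(Suc n + 1) div 2 = n div 2 + 1"
    by simp
  show ?case
    using has_covers_complement[OF has_covers_twin[OF step.IH]]
    unfolding total degree unfolding Suc_eq_plus1 .
qed

theorem theorem11:
  fixes n :: nat
  assumes "n \<ge> 7"
  shows "int (f3_2 n) \<le> \<lfloor>(real n + 1)^2 / 4\<rfloor> - 2"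
proof -
  obtain V :: "nat set" and E F G where *: "finite V" "card V = n" "V \<noteq> {}"
    "E \<subseteq> nsets V 3" "clique_cover V E F" "clique_cover V (complement_edges V E) G"
    "card F + card G \<le> (n + 1)\<^sup>2 div 4 - 2"
    using has_covers_ge_7[OF assms] unfolding has_covers_def by blast
  then have "f3_2 n \<le> num_maximal_cliques V E + num_maximal_cliques V (complement_edges V E)"
    by (intro f3_2_le) (simp_all add: triple_system_def)
  also have "\<dots> \<le> (n + 1)\<^sup>2 div 4 - 2"
    using *(5,6)[THEN num_maximal_cliques_le_card_cover] *(7) by simp
  finally have "f3_2 n \<le> (n + 1)\<^sup>2 div 4 - 2" .
  moreover have "8\<^sup>2 \<le> (n + 1)\<^sup>2"
    using assms by (intro power_mono) auto
  then have "2 \<le> (n + 1)\<^sup>2 div 4"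
    by simp
  moreover have "\<lfloor>(real n + 1)^2 / 4\<rfloor> = int ((n + 1)\<^sup>2 div 4)"
    using floor_divide_of_nat_eq[of "(n + 1)\<^sup>2" 4, where 'a = real] by (simp add: add.commute)
  ultimately show ?thesis
    by linarith
qed

end
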